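(* Let $\Sigma$ be a finite alphabet and let $L\subseteq\Sigma^*$ be a regular language. Then $L$ is in $\mathbf{ZG}$ if and only if $L$ can be expressed as a finite union of languages of the form $$B^*a_1B^*a_2\cdots a_kB^*\cap K,$$ where $k\ge 0$, $B\subseteq\Sigma$, $a_1,\dots,a_k\in\Sigma$, $B\cap\{a_1,\dots,a_k\}=\emptyset$, and $K\subseteq\Sigma^*$ is a regular commutative language.
   Context: For a finite monoid $M$, the idempotent power $\omega>0$ of $M$ is the least positive integer such that $x^\omega$ is idempotent for every $x\in M$. $\mathbf{ZG}$ is the class (variety) of finite monoids satisfying $x^{\omega+1}y=yx^{\omega+1}$ for all elements $x,y$. A regular language is said to be in $\mathbf{ZG}$ if its syntactic monoid is in $\mathbf{ZG}$. The syntactic monoid of $L\subseteq\Sigma^*$ is the quotient of $\Sigma^*$ by the congruence identifying $u,v$ when for all $s,t\in\Sigma^*$, $sut\in L$ iff $svt\in L$. A language is commutative if it is closed under permuting the letters of its words (equivalently, its syntactic monoid is commutative). *)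

theory Defs
  imports "HOL-Algebra.Group" "HOL-Library.Multiset"
begin

text \<open>
  The alphabet is an explicit set \<open>\<Sigma>\<close>, so that the empty alphabet is not excluded;
  \<open>lists \<Sigma>\<close> is the free monoid of words over \<open>\<Sigma>\<close>.
\<close>

text \<open>
  Recognizability by a complete deterministic finite automaton. Taking the states to be
  natural numbers is no restriction, because a finite state set can always be renamed.
\<close>

definition regular_lang :: "'a set \<Rightarrow> 'a list set \<Rightarrow> bool" where
  "regular_lang \<Sigma> L \<longleftrightarrow>
     (\<exists>(Q :: nat set) q0 F \<delta>.
        finite Q \<and> q0 \<in> Q \<and> F \<subseteq> Q \<and> (\<forall>q\<in>Q. \<forall>a\<in>\<Sigma>. \<delta> q a \<in> Q) \<and>
        L = {w \<in> lists \<Sigma>. foldl \<delta> q0 w \<in> F})"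

definition commutative_lang :: "'a list set \<Rightarrow> bool" where
  "commutative_lang L \<longleftrightarrow> (\<forall>u\<in>L. \<forall>v. mset v = mset u \<longrightarrow> v \<in> L)"

definition syn_cong :: "'a set \<Rightarrow> 'a list set \<Rightarrow> ('a list \<times> 'a list) set" where
  "syn_cong \<Sigma> L =
     {(u, v). u \<in> lists \<Sigma> \<and> v \<in> lists \<Sigma> \<and>
        (\<forall>s\<in>lists \<Sigma>. \<forall>t\<in>lists \<Sigma>. s @ u @ t \<in> L \<longleftrightarrow> s @ v @ t \<in> L)}"

text \<open>
  In the product, all the classes over which the union ranges coincide, since
  \<open>syn_cong\<close> is a congruence (see \<open>syn_monoid_mult\<close> below).
\<close>

definition syn_monoid :: "'a set \<Rightarrow> 'a list set \<Rightarrow> 'a list set monoid" where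
  "syn_monoid \<Sigma> L =
     \<lparr>carrier = lists \<Sigma> // syn_cong \<Sigma> L,
      monoid.mult = (\<lambda>X Y. \<Union>u\<in>X. \<Union>v\<in>Y. syn_cong \<Sigma> L `` {u @ v}),
      one = syn_cong \<Sigma> L `` {[]}\<rparr>"

lemma equiv_syn_cong: "equiv (lists \<Sigma>) (syn_cong \<Sigma> L)"
  by (rule equivI) (auto simp: syn_cong_def refl_on_def sym_def trans_def)

lemma syn_cong_append:
  assumes "(u, u') \<in> syn_cong \<Sigma> L" "(v, v') \<in> syn_cong \<Sigma> L"
  shows "(u @ v, u' @ v') \<in> syn_cong \<Sigma> L"
proof -
  have w: "u \<in> lists \<Sigma>" "u' \<in> lists \<Sigma>" "v \<in> lists \<Sigma>" "v' \<in> lists \<Sigma>"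
    using assms by (auto simp: syn_cong_def)
  have "s @ (u @ v) @ t \<in> L \<longleftrightarrow> s @ (u' @ v') @ t \<in> L"
    if st: "s \<in> lists \<Sigma>" "t \<in> lists \<Sigma>" for s t
  proof -
    have "v @ t \<in> lists \<Sigma>" and "s @ u' \<in> lists \<Sigma>"
      using st w by simp_all
    then have "s @ u @ (v @ t) \<in> L \<longleftrightarrow> s @ u' @ (v @ t) \<in> L"
      and "(s @ u') @ v @ t \<in> L \<longleftrightarrow> (s @ u') @ v' @ t \<in> L"
      using assms st unfolding syn_cong_def by blast+
    then show ?thesis by simp
  qed
  then show ?thesis using w by (simp add: syn_cong_def)
qed

lemma syn_monoid_mult:
  assumes "u \<in> lists \<Sigma>" "v \<in> lists \<Sigma>"
  shows "syn_cong \<Sigma> L `` {u} \<otimes>\<^bsub>syn_monoid \<Sigma> L\<^esub> syn_cong \<Sigma> L `` {v} = syn_cong \<Sigma> L `` {u @ v}"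
proof -
  have "syn_cong \<Sigma> L `` {u' @ v'} = syn_cong \<Sigma> L `` {u @ v}"
    if "u' \<in> syn_cong \<Sigma> L `` {u}" "v' \<in> syn_cong \<Sigma> L `` {v}" for u' v'
  proof -
    have "(u, u') \<in> syn_cong \<Sigma> L" "(v, v') \<in> syn_cong \<Sigma> L"
      using that by simp_all
    then have "(u @ v, u' @ v') \<in> syn_cong \<Sigma> L"
      by (rule syn_cong_append)
    then show ?thesis
      by (rule equiv_class_eq[OF equiv_syn_cong, symmetric])
  qed
  moreover have "u \<in> syn_cong \<Sigma> L `` {u}" "v \<in> syn_cong \<Sigma> L `` {v}"
    using assms equiv_class_self[OF equiv_syn_cong] by metis+
  ultimately show ?thesis
    unfolding syn_monoid_def monoid.simps by blast
qed

lemma monoid_syn_monoid: "monoid (syn_monoid \<Sigma> L)"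
proof -
  have cl: "\<exists>u\<in>lists \<Sigma>. X = syn_cong \<Sigma> L `` {u}" if "X \<in> carrier (syn_monoid \<Sigma> L)" for X
    using that by (auto simp: syn_monoid_def elim!: quotientE)
  have car: "syn_cong \<Sigma> L `` {u} \<in> carrier (syn_monoid \<Sigma> L)" if "u \<in> lists \<Sigma>" for u
    using that by (simp add: syn_monoid_def quotientI)
  have one: "\<one>\<^bsub>syn_monoid \<Sigma> L\<^esub> = syn_cong \<Sigma> L `` {[]}"
    by (simp add: syn_monoid_def)
  show ?thesis
  proof (rule monoidI)
    fix X Y assume "X \<in> carrier (syn_monoid \<Sigma> L)" "Y \<in> carrier (syn_monoid \<Sigma> L)"
    then obtain u v where uv: "u \<in> lists \<Sigma>" "X = syn_cong \<Sigma> L `` {u}"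
      "v \<in> lists \<Sigma>" "Y = syn_cong \<Sigma> L `` {v}"
      using cl by blast
    then show "X \<otimes>\<^bsub>syn_monoid \<Sigma> L\<^esub> Y \<in> carrier (syn_monoid \<Sigma> L)"
      using car[of "u @ v"] by (simp add: syn_monoid_mult)
    fix Z assume "Z \<in> carrier (syn_monoid \<Sigma> L)"
    then obtain w where "w \<in> lists \<Sigma>" "Z = syn_cong \<Sigma> L `` {w}"
      using cl by blast
    then show "X \<otimes>\<^bsub>syn_monoid \<Sigma> L\<^esub> Y \<otimes>\<^bsub>syn_monoid \<Sigma> L\<^esub> Z =
      X \<otimes>\<^bsub>syn_monoid \<Sigma> L\<^esub> (Y \<otimes>\<^bsub>syn_monoid \<Sigma> L\<^esub> Z)"
      using uv syn_monoid_mult[of u \<Sigma> v L] syn_monoid_mult[of "u @ v" \<Sigma> w L]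
        syn_monoid_mult[of v \<Sigma> w L] syn_monoid_mult[of u \<Sigma> "v @ w" L] by simp
  next
    show "\<one>\<^bsub>syn_monoid \<Sigma> L\<^esub> \<in> carrier (syn_monoid \<Sigma> L)"
      using car[of "[]"] one by simp
  next
    fix X assume "X \<in> carrier (syn_monoid \<Sigma> L)"
    then obtain u where u: "u \<in> lists \<Sigma>" "X = syn_cong \<Sigma> L `` {u}"
      using cl by blast
    show "\<one>\<^bsub>syn_monoid \<Sigma> L\<^esub> \<otimes>\<^bsub>syn_monoid \<Sigma> L\<^esub> X = X"
      using u one syn_monoid_mult[of "[]" \<Sigma> u L] by simp
    show "X \<otimes>\<^bsub>syn_monoid \<Sigma> L\<^esub> \<one>\<^bsub>syn_monoid \<Sigma> L\<^esub> = X"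
      using u one syn_monoid_mult[of u \<Sigma> "[]" L] by simp
  qed
qed

text \<open>For a finite monoid such an exponent exists, so the \<open>LEAST\<close> is well defined.\<close>

definition idem_power :: "('a, 'b) monoid_scheme \<Rightarrow> nat" where
  "idem_power M =
     (LEAST n. 0 < n \<and>
        (\<forall>x\<in>carrier M. (x [^]\<^bsub>M\<^esub> n) \<otimes>\<^bsub>M\<^esub> (x [^]\<^bsub>M\<^esub> n) = x [^]\<^bsub>M\<^esub> n))"

definition ZG_monoid :: "('a, 'b) monoid_scheme \<Rightarrow> bool" where
  "ZG_monoid M \<longleftrightarrow>
     monoid M \<and> finite (carrier M) \<and>
     (\<forall>x\<in>carrier M. \<forall>y\<in>carrier M.
        (x [^]\<^bsub>M\<^esub> (idem_power M + 1)) \<otimes>\<^bsub>M\<^esub> y = y \<otimes>\<^bsub>M\<^esub> (x [^]\<^bsub>M\<^esub> (idem_power M + 1)))"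

definition ZG_lang :: "'a set \<Rightarrow> 'a list set \<Rightarrow> bool" where
  "ZG_lang \<Sigma> L \<longleftrightarrow> regular_lang \<Sigma> L \<and> ZG_monoid (syn_monoid \<Sigma> L)"

text \<open>\<open>star_word_lang B [a\<^sub>1, \<dots>, a\<^sub>k]\<close> is \<open>B\<^sup>*a\<^sub>1B\<^sup>*\<dots>a\<^sub>kB\<^sup>*\<close>, with \<open>lists B\<close> for \<open>B\<^sup>*\<close>.\<close>

definition conc :: "'a list set \<Rightarrow> 'a list set \<Rightarrow> 'a list set" where
  "conc U V = {u @ v | u v. u \<in> U \<and> v \<in> V}"

fun star_word_lang :: "'a set \<Rightarrow> 'a list \<Rightarrow> 'a list set" where
  "star_word_lang B [] = lists B"
| "star_word_lang B (a # as) = conc (lists B) (conc {[a]} (star_word_lang B as))"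

end

theory Submission
  imports Defs
begin

text \<open>
  Let \<open>n\<close> be the size and \<open>k\<close> the idempotent power of a monoid in ZG, and let \<open>h\<close> be a morphism
  from words to it. If a letter \<open>a\<close> occurs more than \<open>n\<close> times in \<open>w\<close>, then by the pigeonhole
  principle a prefix of \<open>w\<close> absorbs some \<open>e = (h (a @ t))\<^sup>k\<close>; since idempotents are central, \<open>e\<close>
  absorbs \<open>h(a)\<^sup>k\<close>, hence so does \<open>h w\<close>. In the presence of \<open>h(a)\<^sup>k\<close> every occurrence of \<open>a\<close>
  can be commuted to the end, so \<open>h w\<close> is determined by the subword of the rare letters and by
  the number modulo \<open>k\<close> of occurrences of each frequent letter.

  Conversely, if \<open>m\<close> exceeds the number of marked letters \<open>a\<^sub>1, \<dots>, a\<^sub>j\<close>, then a word with a factor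
  \<open>x\<^sup>m\<close> can be in \<open>B\<^sup>*a\<^sub>1B\<^sup>*\<dots>a\<^sub>jB\<^sup>*\<close> only if \<open>x\<close> is over \<open>B\<close>, and then \<open>x\<^sup>m\<close> can be moved freely.
\<close>

subsection \<open>Idempotent powers\<close>

context monoid
begin

text \<open>An idempotent equals all its positive powers. Writing the multiple as
  \<open>Suc q\<close> keeps out the exponent 0, which would give the identity.\<close>

lemma idem_pow_mult:
  assumes "x \<in> carrier G" "(x [^] k) \<otimes> (x [^] k) = x [^] (k::nat)"
  shows "x [^] (k * Suc q) = x [^] k"
proof (induction q)
  case (Suc q)
  have "x [^] (k * Suc (Suc q)) = x [^] (k * Suc q) \<otimes> x [^] k"
    using assms(1) by (simp add: nat_pow_mult algebra_simps)
  then show ?case using Suc assms(2) by simp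
qed simp

text \<open>By finiteness two powers of \<open>x\<close> coincide, so the powers are periodic from
  some exponent on; a large enough multiple of a period gives an idempotent.\<close>

lemma ex_idem_pow:
  assumes "finite (carrier G)" and x: "x \<in> carrier G"
  shows "\<exists>n::nat. 0 < n \<and> (x [^] n) \<otimes> (x [^] n) = x [^] n"
proof -
  have "\<not> inj (\<lambda>n::nat. x [^] n)"
    using x assms(1) by (intro notI) (metis finite_subset image_subsetI infinite_UNIV_nat nat_pow_closed
        finite_imageD)
  then obtain i j :: nat where "i < j" and eq: "x [^] i = x [^] j"
    unfolding inj_def by (metis nat_neq_iff)
  define p where "p = j - i"
  have p: "0 < p" "x [^] (i + p) = x [^] i"
    using \<open>i < j\<close> eq by (auto simp: p_def)
  have step: "x [^] (m + p) = x [^] m" if "i \<le> m" for m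
  proof -
    have "x [^] (m + p) = x [^] (i + p) \<otimes> x [^] (m - i)"
      using that x by (simp add: nat_pow_mult add.commute)
    also have "\<dots> = x [^] m"
      unfolding p(2) using that x by (simp add: nat_pow_mult)
    finally show ?thesis .
  qed
  have "x [^] (m + q * p) = x [^] m" if "i \<le> m" for m q
  proof (induction q)
    case (Suc q)
    then show ?case using step[of "m + q * p"] that by (simp add: algebra_simps)
  qed simp
  \<comment> \<open>\<open>Suc i * p\<close> lies in the periodic range, and doubling it adds a
    multiple of the period \<open>p\<close>.\<close>
  moreover have "i \<le> Suc i * p" using p(1) by (cases p) auto
  ultimately have "x [^] (Suc i * p + Suc i * p) = x [^] (Suc i * p)" by blast
  then show ?thesis using x p(1) by (intro exI[of _ "Suc i * p"]) (simp add: nat_pow_mult)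
qed

text \<open>The product of the exponents of the single elements is a positive multiple of each of
  them.\<close>

lemma ex_common_idem_pow:
  assumes "finite (carrier G)"
  shows "\<exists>n::nat. 0 < n \<and> (\<forall>x\<in>carrier G. (x [^] n) \<otimes> (x [^] n) = x [^] n)"
proof -
  obtain f :: "'a \<Rightarrow> nat"
    where f: "0 < f x" "(x [^] f x) \<otimes> (x [^] f x) = x [^] f x" if "x \<in> carrier G" for x
    using ex_idem_pow[OF assms] by metis
  have "(x [^] prod f (carrier G)) \<otimes> (x [^] prod f (carrier G)) = x [^] prod f (carrier G)"
    if x: "x \<in> carrier G" for x
  proof -
    have "0 < prod f (carrier G)" using f(1) by (simp add: prod_pos)
    moreover have "f x dvd prod f (carrier G)" using assms x by (rule dvd_prodI)
    ultimately obtain q where "prod f (carrier G) = f x * Suc q"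
      by (metis dvd_def gr0_implies_Suc mult_0_right neq0_conv)
    then show ?thesis using idem_pow_mult[OF x f(2)[OF x]] f(2)[OF x] by simp
  qed
  then show ?thesis using f(1) by (intro exI[of _ "prod f (carrier G)"]) (simp add: prod_pos)
qed

lemma idem_power_pos:
  assumes "finite (carrier G)"
  shows "0 < idem_power G"
  using LeastI_ex[OF ex_common_idem_pow[OF assms]] unfolding idem_power_def by simp

lemma idem_power_idem:
  assumes "finite (carrier G)" "x \<in> carrier G"
  shows "(x [^] idem_power G) \<otimes> (x [^] idem_power G) = x [^] idem_power G"
  using LeastI_ex[OF ex_common_idem_pow[OF assms(1)]] assms(2) unfolding idem_power_def by simp

end

subsection \<open>Words evaluated in a monoid in ZG\<close>

locale zg_monoid = monoid G for G (structure) +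
  fixes k :: nat
  assumes fin: "finite (carrier G)"
    and idem: "x \<in> carrier G \<Longrightarrow> (x [^] k) \<otimes> (x [^] k) = x [^] k"
    and central: "x \<in> carrier G \<Longrightarrow> y \<in> carrier G \<Longrightarrow> (x [^] (k + 1)) \<otimes> y = y \<otimes> (x [^] (k + 1))"
begin

text \<open>Every such power is a product of central powers: \<open>x^k\<close> equals
  \<open>(x^(k+1))^k\<close>, and an extra copy of the idempotent \<open>x^k\<close> splits
  \<open>x^(k+m+1)\<close> into \<open>x^(k+m)\<close> and \<open>x^(k+1)\<close>.\<close>

lemma pow_central:
  assumes "x \<in> carrier G" "y \<in> carrier G"
  shows "(x [^] (k + m)) \<otimes> y = y \<otimes> (x [^] (k + m))"
proof (induction m)
  case 0
  have "(x [^] (k + 1)) [^] k = x [^] (k * Suc k)"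
    using nat_pow_pow[OF assms(1), of "k + 1" k] by (metis Suc_eq_plus1 mult.commute)
  then have "(x [^] (k + 1)) [^] k = x [^] k"
    using idem_pow_mult[OF assms(1) idem[OF assms(1)]] by metis
  then show ?case
    using group_commutes_pow[OF central[OF assms], of k] assms by simp
next
  case (Suc m)
  have "x [^] (k + Suc m) = x [^] k \<otimes> x [^] k \<otimes> x [^] Suc m"
    using idem[OF assms(1)] nat_pow_mult[OF assms(1), of k "Suc m"] by simp
  also have "\<dots> = x [^] (k + m) \<otimes> x [^] (k + 1)"
    unfolding nat_pow_mult[OF assms(1)] by (rule arg_cong[of _ _ "\<lambda>i. x [^] i"]) simp
  finally have eq: "x [^] (k + Suc m) = x [^] (k + m) \<otimes> x [^] (k + 1)" .
  have "x [^] (k + m) \<otimes> x [^] (k + 1) \<otimes> y = x [^] (k + m) \<otimes> y \<otimes> x [^] (k + 1)"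
    using assms central[OF assms] by (simp add: m_assoc del: nat_pow_Suc)
  also have "\<dots> = y \<otimes> (x [^] (k + m) \<otimes> x [^] (k + 1))"
    unfolding Suc using assms by (simp add: m_assoc del: nat_pow_Suc)
  finally show ?case unfolding eq .
qed

text \<open>The idempotent \<open>x^k\<close> absorbs whole multiples of \<open>k\<close>, so only
  the residue of the remaining exponent survives.\<close>

lemma pow_mod:
  assumes "x \<in> carrier G"
  shows "x [^] (k + m) = x [^] (k + m mod k)"
proof -
  have "x [^] (k + m) = x [^] (k * Suc (m div k) + m mod k)"
    by (simp add: algebra_simps)
  also have "\<dots> = x [^] (k * Suc (m div k)) \<otimes> x [^] (m mod k)"
    using assms by (simp add: nat_pow_mult)
  also have "\<dots> = x [^] (k + m mod k)"
    unfolding idem_pow_mult[OF assms idem[OF assms]] using assms by (simp add: nat_pow_mult)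
  finally show ?thesis .
qed

text \<open>Relative to the central idempotent \<open>e = (a t)^k\<close>, the element
  \<open>a\<close> has a right inverse \<open>c\<close>, so \<open>e = e a^k c^k\<close>. Since
  \<open>a^k\<close> is idempotent and central, a further factor \<open>a^k\<close> changes
  nothing.\<close>

lemma idem_absorbs_left_factor:
  assumes a: "a \<in> carrier G" and t: "t \<in> carrier G" and "0 < k"
  shows "(a \<otimes> t) [^] k \<otimes> a [^] k = (a \<otimes> t) [^] k"
proof -
  define e where "e = (a \<otimes> t) [^] k"
  \<comment> \<open>What is left of \<open>(a t)^k\<close> after its first factor \<open>a\<close>;
    positivity of \<open>k\<close> makes \<open>k - 1\<close> a true predecessor.\<close>
  define c where "c = t \<otimes> (a \<otimes> t) [^] (k - 1)"
  have car: "e \<in> carrier G" "c \<in> carrier G" using a t by (auto simp: e_def c_def)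
  have e_comm: "e \<otimes> y = y \<otimes> e" if "y \<in> carrier G" for y
    using pow_central[of "a \<otimes> t" y 0] a t that by (simp add: e_def)
  have ee: "e \<otimes> e = e" using idem a t by (simp add: e_def)
  have "a \<otimes> c = (a \<otimes> t) \<otimes> (a \<otimes> t) [^] (k - 1)" using a t by (simp add: c_def m_assoc)
  also have "\<dots> = (a \<otimes> t) [^] Suc (k - 1)"
    using a t by (metis m_closed nat_pow_Suc2)
  also have "\<dots> = e" using \<open>0 < k\<close> by (simp add: e_def del: nat_pow_Suc)
  finally have ac: "a \<otimes> c = e" .
  \<comment> \<open>The innermost product \<open>a c\<close> is \<open>e\<close>; being central it
    moves to the front, where \<open>e\<close> absorbs it.\<close>
  have inv: "e \<otimes> (a [^] j \<otimes> c [^] j) = e" for j :: nat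
  proof (induction j)
    case 0 then show ?case using car by simp
  next
    case (Suc j)
    have "a [^] Suc j \<otimes> c [^] Suc j = (a [^] j \<otimes> a) \<otimes> (c \<otimes> c [^] j)"
      unfolding nat_pow_Suc2[OF car(2)] nat_pow_Suc[of a] ..
    also have "\<dots> = a [^] j \<otimes> (a \<otimes> c) \<otimes> c [^] j"
      using a car by (simp add: m_assoc)
    also have "\<dots> = e \<otimes> (a [^] j \<otimes> c [^] j)"
      unfolding ac using e_comm[of "a [^] j"] a car by (simp add: m_assoc[symmetric])
    finally have "e \<otimes> (a [^] Suc j \<otimes> c [^] Suc j) = e \<otimes> e \<otimes> (a [^] j \<otimes> c [^] j)"
      using car a by (simp add: m_assoc del: nat_pow_Suc)
    then show ?case unfolding ee Suc .
  qed
  have ak: "a [^] k \<otimes> y = y \<otimes> a [^] k" if "y \<in> carrier G" for y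
    using pow_central[OF a that, of 0] by simp
  have "e \<otimes> a [^] k = e \<otimes> (a [^] k \<otimes> c [^] k) \<otimes> a [^] k" using inv by simp
  also have "\<dots> = e \<otimes> (a [^] k \<otimes> (a [^] k \<otimes> c [^] k))"
    using a car ak[of "a [^] k \<otimes> c [^] k"] by (simp only: m_assoc m_closed nat_pow_closed)
  also have "\<dots> = e \<otimes> (a [^] k \<otimes> a [^] k \<otimes> c [^] k)"
    using a car by (simp only: m_assoc m_closed nat_pow_closed)
  also have "\<dots> = e" using inv idem a by simp
  finally show ?thesis by (simp add: e_def)
qed

end

section \<open>Frequent and rare letters under a morphism\<close>

locale zg_word_morphism = zg_monoid +
  fixes \<Sigma> :: "'c set" and h :: "'c list \<Rightarrow> 'a"
  assumes h_closed [simp]: "w \<in> lists \<Sigma> \<Longrightarrow> h w \<in> carrier G"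
    and h_append: "v \<in> lists \<Sigma> \<Longrightarrow> w \<in> lists \<Sigma> \<Longrightarrow> h (v @ w) = h v \<otimes> h w"
    and k_pos: "0 < k"
begin

lemma h_letter_closed [simp]: "a \<in> \<Sigma> \<Longrightarrow> h [a] \<in> carrier G"
  by simp

text \<open>Among the prefixes that end just before an occurrence of \<open>a\<close>, two have the
  same image. They differ by a factor beginning with \<open>a\<close>, and the common image absorbs
  every power of that factor.\<close>

lemma frequent_absorbed:
  assumes w: "w \<in> lists \<Sigma>" and count: "card (carrier G) < count_list w a"
  shows "h w \<otimes> h [a] [^] k = h w"
proof -
  define P where "P = {i. i < length w \<and> w ! i = a}"
  have "count_list w a = card P"
    unfolding P_def count_list_eq_length_filter length_filter_conv_card
    by (rule arg_cong[of _ _ card]) auto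
  moreover have "(\<lambda>i. h (take i w)) ` P \<subseteq> carrier G"
    using w by (intro image_subsetI h_closed) (auto simp: in_lists_conv_set dest: in_set_takeD)
  ultimately have "\<not> inj_on (\<lambda>i. h (take i w)) P"
    using card_inj_on_le[OF _ _ fin] count by (metis not_le)
  then obtain i j where "i \<in> P" "j \<in> P" "i < j" and eq: "h (take i w) = h (take j w)"
    unfolding inj_on_def by (metis nat_neq_iff)
  then have ij: "i < length w" "w ! i = a" "j < length w" by (auto simp: P_def)
  define p where "p = h (take i w)"
  \<comment> \<open>The factor of \<open>w\<close> from position \<open>i\<close> up to, but
    excluding, position \<open>j\<close> is \<open>a # u\<close>.\<close>
  define u where "u = take (j - Suc i) (drop (Suc i) w)"
  have sets: "a \<in> \<Sigma>" "u \<in> lists \<Sigma>" "take i w \<in> lists \<Sigma>" "drop i w \<in> lists \<Sigma>"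
    using w ij by (auto simp: u_def in_lists_conv_set dest!: in_set_takeD in_set_dropD)
  have "take j w = take i w @ take (j - i) (drop i w)"
    using \<open>i < j\<close> take_add[of i "j - i" w] by simp
  also have "take (j - i) (drop i w) = a # u"
    using Cons_nth_drop_Suc[OF ij(1)] Suc_diff_Suc[OF \<open>i < j\<close>] ij(2)
    unfolding u_def by (metis take_Suc_Cons)
  finally have "take j w = take i w @ a # u" .
  then have p_absorb: "p \<otimes> (h [a] \<otimes> h u) = p"
    using eq sets h_append[of "take i w" "a # u"] h_append[of "[a]" u] by (simp add: p_def)
  have car: "p \<in> carrier G" "h u \<in> carrier G" "h [a] \<in> carrier G" "h (drop i w) \<in> carrier G"
    using sets by (simp_all add: p_def)
  have "p \<otimes> (h [a] \<otimes> h u) [^] m = p" for m :: nat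
  proof (induction m)
    case (Suc m)
    then show ?case using p_absorb car by (simp add: m_assoc[symmetric])
  qed (use car in simp)
  then have "p \<otimes> h [a] [^] k = p \<otimes> ((h [a] \<otimes> h u) [^] k \<otimes> h [a] [^] k)"
    using car by (simp add: m_assoc[symmetric])
  also have "\<dots> = p"
    unfolding idem_absorbs_left_factor[OF car(3,2) k_pos] by fact
  finally have "p \<otimes> h [a] [^] k = p" .
  have split: "h w = p \<otimes> h (drop i w)"
    using h_append[OF sets(3,4)] by (simp add: p_def)
  \<comment> \<open>Centrality carries the power from the end of the word back to the absorbing
    prefix.\<close>
  have "h (drop i w) \<otimes> h [a] [^] k = h [a] [^] k \<otimes> h (drop i w)"
    using pow_central[of "h [a]" "h (drop i w)" 0] car by simp
  then have "h w \<otimes> h [a] [^] k = p \<otimes> h [a] [^] k \<otimes> h (drop i w)"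
    unfolding split using car by (simp add: m_assoc)
  then show ?thesis unfolding \<open>p \<otimes> h [a] [^] k = p\<close> split .
qed

text \<open>Once \<open>h [a] [^] k\<close> is present, powers with exponent at least
  \<open>k\<close> are central: each \<open>a\<close> joins the power and every other letter passes
  it. The induction runs from the right because the power stands there.\<close>

lemma extract_letter:
  assumes "w \<in> lists \<Sigma>" and a: "a \<in> \<Sigma>"
  shows "h w \<otimes> h [a] [^] k = h (filter (\<lambda>c. c \<noteq> a) w) \<otimes> h [a] [^] (k + count_list w a)"
  using assms(1)
proof (induction w rule: rev_induct)
  case Nil
  then show ?case by simp
next
  case (snoc b w)
  define \<alpha> where "\<alpha> = h [a]"
  define f where "f = filter (\<lambda>c. c \<noteq> a) w"
  define n where "n = count_list w a"
  have w: "w \<in> lists \<Sigma>" "b \<in> \<Sigma>" "f \<in> lists \<Sigma>" using snoc.prems by (auto simp: f_def)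
  have car: "h w \<in> carrier G" "h [b] \<in> carrier G" "\<alpha> \<in> carrier G" "h f \<in> carrier G"
    using w a by (simp_all add: \<alpha>_def)
  have IH: "h w \<otimes> \<alpha> [^] k = h f \<otimes> \<alpha> [^] (k + n)"
    using snoc.IH[OF w(1)] by (simp add: \<alpha>_def f_def n_def)
  have "h (w @ [b]) \<otimes> \<alpha> [^] k = h w \<otimes> (h [b] \<otimes> \<alpha> [^] k)"
    using w car by (simp add: h_append m_assoc)
  also have "\<dots> = h w \<otimes> \<alpha> [^] k \<otimes> h [b]"
    using pow_central[OF car(3,2), of 0] car by (simp add: m_assoc)
  finally have eq: "h (w @ [b]) \<otimes> \<alpha> [^] k = h f \<otimes> \<alpha> [^] (k + n) \<otimes> h [b]"
    unfolding IH .
  show ?case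
  proof (cases "b = a")
    case True
    have "h f \<otimes> \<alpha> [^] (k + n) \<otimes> \<alpha> = h f \<otimes> \<alpha> [^] (k + Suc n)"
      using car by (simp add: m_assoc)
    then show ?thesis using eq True by (simp add: \<alpha>_def f_def n_def)
  next
    case False
    have "h f \<otimes> \<alpha> [^] (k + n) \<otimes> h [b] = h (f @ [b]) \<otimes> \<alpha> [^] (k + n)"
      using pow_central[OF car(3,2), of n] car w by (simp add: m_assoc h_append)
    then show ?thesis using eq False by (simp add: \<alpha>_def f_def n_def)
  qed
qed

text \<open>The witness \<open>e\<close> is the product of the idempotents \<open>h(b)\<^sup>k\<close> for \<open>b \<in> B\<close>.\<close>

lemma ex_idem_separator:
  assumes "finite B" "B \<subseteq> \<Sigma>"
  shows "\<exists>e\<in>carrier G.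
    (\<forall>x\<in>carrier G. (\<forall>b\<in>B. x \<otimes> h [b] [^] k = x) \<longrightarrow> x \<otimes> e = x) \<and>
    (\<forall>v\<in>lists \<Sigma>. \<forall>w\<in>lists \<Sigma>.
       filter (\<lambda>c. c \<notin> B) v = filter (\<lambda>c. c \<notin> B) w \<longrightarrow>
       (\<forall>b\<in>B. count_list v b mod k = count_list w b mod k) \<longrightarrow> h v \<otimes> e = h w \<otimes> e)"
  using assms
proof (induction B)
  case empty
  \<comment> \<open>The empty product of idempotents; for empty \<open>B\<close> the filter
    condition already says that the words are equal.\<close>
  then show ?case by (intro bexI[of _ \<one>]) auto
next
  case (insert b B)
  have b: "b \<in> \<Sigma>" and "B \<subseteq> \<Sigma>" using insert.prems by simp_all
  obtain e where e: "e \<in> carrier G"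
    and e_absorb: "\<forall>x\<in>carrier G. (\<forall>b\<in>B. x \<otimes> h [b] [^] k = x) \<longrightarrow> x \<otimes> e = x"
    and e_eq: "\<forall>v\<in>lists \<Sigma>. \<forall>w\<in>lists \<Sigma>.
       filter (\<lambda>c. c \<notin> B) v = filter (\<lambda>c. c \<notin> B) w \<longrightarrow>
       (\<forall>b\<in>B. count_list v b mod k = count_list w b mod k) \<longrightarrow> h v \<otimes> e = h w \<otimes> e"
    using insert.IH[OF \<open>B \<subseteq> \<Sigma>\<close>] by (elim bexE conjE)
  define \<beta> where "\<beta> = h [b]"
  have \<beta>: "\<beta> \<in> carrier G" using b by (simp add: \<beta>_def)
  define e' where "e' = \<beta> [^] k \<otimes> e"
  have e': "e' \<in> carrier G" using \<beta> e by (simp add: e'_def)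
  have absorb: "x \<otimes> e' = x" if "x \<in> carrier G" "\<forall>b\<in>insert b B. x \<otimes> h [b] [^] k = x" for x
  proof -
    have "x \<otimes> e' = x \<otimes> \<beta> [^] k \<otimes> e" using that(1) \<beta> e by (simp add: e'_def m_assoc)
    then show ?thesis using that e_absorb by (simp add: \<beta>_def)
  qed
  have equal: "h v \<otimes> e' = h w \<otimes> e'"
    if v: "v \<in> lists \<Sigma>" and w: "w \<in> lists \<Sigma>"
      and rare: "filter (\<lambda>c. c \<notin> insert b B) v = filter (\<lambda>c. c \<notin> insert b B) w"
      and mod: "\<forall>b\<in>insert b B. count_list v b mod k = count_list w b mod k" for v w
  proof -
    define r where "r = filter (\<lambda>c. c \<noteq> b)"
    have r: "r u \<in> lists \<Sigma>" if "u \<in> lists \<Sigma>" for u using that by (auto simp: r_def)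
    \<comment> \<open>Extracting \<open>b\<close> leaves \<open>e\<close> next to a word free of
      \<open>b\<close>, so the induction hypothesis applies to \<open>r v\<close> and
      \<open>r w\<close>.\<close>
    have move: "h u \<otimes> e' = h (r u) \<otimes> e \<otimes> \<beta> [^] (k + count_list u b)" if u: "u \<in> lists \<Sigma>" for u
    proof -
      have "h u \<otimes> e' = h u \<otimes> \<beta> [^] k \<otimes> e"
        using u \<beta> e by (simp add: e'_def m_assoc)
      also have "\<dots> = h (r u) \<otimes> \<beta> [^] (k + count_list u b) \<otimes> e"
        using extract_letter[OF u b] by (simp add: r_def \<beta>_def)
      finally show ?thesis
        using pow_central[OF \<beta> e, of "count_list u b"] \<beta> e r[OF u] by (simp add: m_assoc)
    qed
    have "filter (\<lambda>c. c \<notin> B) (r u) = filter (\<lambda>c. c \<notin> insert b B) u" for u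
      unfolding r_def filter_filter by (rule filter_cong) auto
    moreover have "count_list (r u) c = count_list u c" if "c \<in> B" for u c
      using that insert.hyps(2) by (induction u) (auto simp: r_def)
    ultimately have "h (r v) \<otimes> e = h (r w) \<otimes> e"
      using rare mod by (intro e_eq[rule_format] r v w) simp_all
    \<comment> \<open>The exponents may differ, but beyond \<open>k\<close> only their residues
      count.\<close>
    moreover have "\<beta> [^] (k + count_list v b) = \<beta> [^] (k + count_list w b)"
      using pow_mod[OF \<beta>, of "count_list v b"] pow_mod[OF \<beta>, of "count_list w b"] mod by simp
    ultimately show ?thesis unfolding move[OF v] move[OF w] by simp
  qed
  show ?case
    by (intro bexI[OF _ e'] conjI ballI impI; rule absorb equal; assumption)
qed

text \<open>Frequency lets both images absorb the idempotents of the letters in \<open>B\<close>,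
  hence also the separator \<open>e\<close>, so the equality after multiplication by
  \<open>e\<close> is an equality of the images themselves.\<close>

lemma image_determined:
  assumes "finite B" "B \<subseteq> \<Sigma>" and v: "v \<in> lists \<Sigma>" and w: "w \<in> lists \<Sigma>"
    and frequent: "\<And>b. b \<in> B \<Longrightarrow> card (carrier G) < count_list v b"
      "\<And>b. b \<in> B \<Longrightarrow> card (carrier G) < count_list w b"
    and "filter (\<lambda>c. c \<notin> B) v = filter (\<lambda>c. c \<notin> B) w"
    and "\<And>b. b \<in> B \<Longrightarrow> count_list v b mod k = count_list w b mod k"
  shows "h v = h w"
proof -
  obtain e
    where absorb: "\<forall>x\<in>carrier G. (\<forall>b\<in>B. x \<otimes> h [b] [^] k = x) \<longrightarrow> x \<otimes> e = x"
      and equal: "\<forall>v\<in>lists \<Sigma>. \<forall>w\<in>lists \<Sigma>.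
       filter (\<lambda>c. c \<notin> B) v = filter (\<lambda>c. c \<notin> B) w \<longrightarrow>
       (\<forall>b\<in>B. count_list v b mod k = count_list w b mod k) \<longrightarrow> h v \<otimes> e = h w \<otimes> e"
    using ex_idem_separator[OF assms(1,2)] by (elim bexE conjE)
  have "h v \<otimes> e = h w \<otimes> e"
    using assms(7,8) by (intro equal[rule_format] v w)
  moreover have "h v \<otimes> e = h v"
    by (intro absorb[rule_format] h_closed v frequent_absorbed frequent)
  moreover have "h w \<otimes> e = h w"
    by (intro absorb[rule_format] h_closed w frequent_absorbed frequent)
  ultimately show ?thesis by simp
qed

end

subsection \<open>Regular languages\<close>

lemma foldl_closed:
  "q \<in> Q \<Longrightarrow> \<forall>q\<in>Q. \<forall>a\<in>\<Sigma>. \<delta> q a \<in> Q \<Longrightarrow> w \<in> lists \<Sigma> \<Longrightarrow> foldl \<delta> q w \<in> Q"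
  by (induction w arbitrary: q) auto

text \<open>A Myhill-Nerode criterion: the fibres of \<open>h\<close> form a right-invariant
  partition of finite index that saturates \<open>L\<close>, and they serve as states.\<close>

lemma regular_langI:
  fixes h :: "'a list \<Rightarrow> 'b"
  assumes fin: "finite (h ` lists \<Sigma>)" and "L \<subseteq> lists \<Sigma>"
    and step: "\<And>u v a. u \<in> lists \<Sigma> \<Longrightarrow> v \<in> lists \<Sigma> \<Longrightarrow> a \<in> \<Sigma> \<Longrightarrow> h u = h v \<Longrightarrow> h (u @ [a]) = h (v @ [a])"
    and sat: "\<And>u v. u \<in> lists \<Sigma> \<Longrightarrow> v \<in> lists \<Sigma> \<Longrightarrow> h u = h v \<Longrightarrow> u \<in> L \<Longrightarrow> v \<in> L"
  shows "regular_lang \<Sigma> L"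
proof -
  \<comment> \<open>Automata have natural numbers as states, so the values of \<open>h\<close> are
    renamed injectively.\<close>
  obtain f :: "'b \<Rightarrow> nat" where f: "inj_on f (h ` lists \<Sigma>)"
    using finite_imp_inj_to_nat_seg[OF fin] by blast
  define g where "g w = f (h w)" for w
  have g_eq: "g u = g v \<longleftrightarrow> h u = h v" if "u \<in> lists \<Sigma>" "v \<in> lists \<Sigma>" for u v
    using that f by (auto simp: g_def inj_on_def)
  define rep where "rep q = (SOME u. u \<in> lists \<Sigma> \<and> g u = q)" for q
  have rep: "rep (g u) \<in> lists \<Sigma> \<and> g (rep (g u)) = g u" if "u \<in> lists \<Sigma>" for u
    unfolding rep_def by (rule someI[of _ u]) (use that in simp)
  \<comment> \<open>A transition appends the letter to a chosen representative; \<open>step\<close>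
    makes the result independent of the choice.\<close>
  define \<delta> where "\<delta> q a = g (rep q @ [a])" for q a
  have \<delta>: "\<delta> (g u) a = g (u @ [a])" if "u \<in> lists \<Sigma>" "a \<in> \<Sigma>" for u a
  proof -
    note r = rep[OF that(1), THEN conjunct1] rep[OF that(1), THEN conjunct2]
    have "h (rep (g u)) = h u" using r(2) unfolding g_eq[OF r(1) that(1)] .
    then show ?thesis unfolding \<delta>_def g_def[of "u @ [a]"] g_def[of "rep (g u) @ [a]"]
      by (intro arg_cong[of _ _ f] step r(1) that)
  qed
  have run: "foldl \<delta> (g []) w = g w" if "w \<in> lists \<Sigma>" for w
    using that
  proof (induction w rule: rev_induct)
    case (snoc a w)
    then have "w \<in> lists \<Sigma>" "a \<in> \<Sigma>" by simp_all
    then show ?case using snoc.IH \<delta> by simp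
  qed simp
  have "L = {w \<in> lists \<Sigma>. foldl \<delta> (g []) w \<in> g ` L}"
  proof (intro equalityI subsetI CollectI conjI)
    fix w assume "w \<in> L"
    then show w: "w \<in> lists \<Sigma>" using \<open>L \<subseteq> lists \<Sigma>\<close> by blast
    show "foldl \<delta> (g []) w \<in> g ` L" unfolding run[OF w] using \<open>w \<in> L\<close> by (rule imageI)
  next
    fix w assume "w \<in> {w \<in> lists \<Sigma>. foldl \<delta> (g []) w \<in> g ` L}"
    then have w: "w \<in> lists \<Sigma>" and "foldl \<delta> (g []) w \<in> g ` L" by simp_all
    from this(2) obtain u where u: "g w = g u" "u \<in> L" unfolding run[OF w] by (rule imageE)
    then have u': "u \<in> lists \<Sigma>" using \<open>L \<subseteq> lists \<Sigma>\<close> by blast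
    have "h u = h w" using u(1)[symmetric] unfolding g_eq[OF u' w] .
    with u' w show "w \<in> L" using u(2) by (rule sat)
  qed
  moreover have "finite (g ` lists \<Sigma>)"
    using finite_imageI[OF fin, of f] unfolding g_def image_image .
  moreover have "g ` L \<subseteq> g ` lists \<Sigma>"
    using \<open>L \<subseteq> lists \<Sigma>\<close> by (rule image_mono)
  moreover have "\<delta> q a \<in> g ` lists \<Sigma>" if "q \<in> g ` lists \<Sigma>" "a \<in> \<Sigma>" for q a
  proof -
    from that(1) obtain u where u: "q = g u" "u \<in> lists \<Sigma>" by (rule imageE)
    have "u @ [a] \<in> lists \<Sigma>" using u(2) that(2) by simp
    then show ?thesis unfolding u(1) \<delta>[OF u(2) that(2)] by (rule imageI)
  qed
  moreover have "g [] \<in> g ` lists \<Sigma>" by (rule imageI) simp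
  ultimately show ?thesis
    unfolding regular_lang_def
    by (intro exI[of _ "g ` lists \<Sigma>"] exI[of _ "g []"] exI[of _ "g ` L"] exI[of _ \<delta>] conjI ballI)
qed

text \<open>Letter counts truncated at \<open>Suc n\<close> and taken modulo \<open>k\<close> have
  finitely many values and can be updated letter by letter. Truncation at \<open>Suc n\<close> is
  just fine enough to decide whether a count exceeds \<open>n\<close>.\<close>

lemma regular_count_lang:
  assumes "finite \<Sigma>" "0 < k" "K \<subseteq> lists \<Sigma>"
    and sat: "\<And>u v. u \<in> K \<Longrightarrow> v \<in> lists \<Sigma> \<Longrightarrow>
      (\<And>a. a \<in> \<Sigma> \<Longrightarrow> min (Suc n) (count_list u a) = min (Suc n) (count_list v a)) \<Longrightarrow>
      (\<And>a. a \<in> \<Sigma> \<Longrightarrow> count_list u a mod k = count_list v a mod k) \<Longrightarrow> v \<in> K"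
  shows "regular_lang \<Sigma> K"
proof (rule regular_langI)
  define h where "h w = (\<lambda>a\<in>\<Sigma>. (min (Suc n) (count_list w a), count_list w a mod k))" for w
  have "h ` lists \<Sigma> \<subseteq> (\<Pi>\<^sub>E a\<in>\<Sigma>. {..Suc n} \<times> {..<k})"
    using \<open>0 < k\<close> by (auto simp: h_def)
  moreover have "finite (\<Pi>\<^sub>E a\<in>\<Sigma>. {..Suc n} \<times> {..<k})"
    using \<open>finite \<Sigma>\<close> by (intro finite_PiE) auto
  ultimately show "finite (h ` lists \<Sigma>)" by (rule finite_subset)
  have h_eq: "h u = h v \<longleftrightarrow>
      (\<forall>a\<in>\<Sigma>. min (Suc n) (count_list u a) = min (Suc n) (count_list v a) \<and>
             count_list u a mod k = count_list v a mod k)" for u v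
    unfolding h_def by (auto simp: restrict_def fun_eq_iff)
  show "h (u @ [a]) = h (v @ [a])" if "h u = h v" for u v a
    unfolding h_eq
  proof
    fix c assume "c \<in> \<Sigma>"
    then have eq: "min (Suc n) (count_list u c) = min (Suc n) (count_list v c)"
      "count_list u c mod k = count_list v c mod k"
      using that unfolding h_eq by blast+
    have "min (Suc n) (count_list u c + d) = min (Suc n) (count_list v c + d)" for d
      using eq(1) by linarith
    moreover have "(count_list u c + d) mod k = (count_list v c + d) mod k" for d
      using eq(2) by (rule mod_add_cong) (rule refl)
    ultimately show "min (Suc n) (count_list (u @ [a]) c) = min (Suc n) (count_list (v @ [a]) c) \<and>
        count_list (u @ [a]) c mod k = count_list (v @ [a]) c mod k"
      unfolding count_list_append by blast
  qed
  show "v \<in> K" if v: "v \<in> lists \<Sigma>" and "h u = h v" and u: "u \<in> K" for u v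
  proof (rule sat[OF u v])
    fix a assume "a \<in> \<Sigma>"
    then show "min (Suc n) (count_list u a) = min (Suc n) (count_list v a)"
      "count_list u a mod k = count_list v a mod k"
      using \<open>h u = h v\<close> unfolding h_eq by blast+
  qed
qed fact

text \<open>Words that act alike on the states are syntactically congruent, and a finite state set
  has only finitely many transformations.\<close>

lemma finite_syn_monoid:
  assumes "regular_lang \<Sigma> L"
  shows "finite (carrier (syn_monoid \<Sigma> L))"
proof -
  obtain Q :: "nat set" and q0 F \<delta> where Q: "finite Q" "q0 \<in> Q" "\<forall>q\<in>Q. \<forall>a\<in>\<Sigma>. \<delta> q a \<in> Q"
    and L: "L = {w \<in> lists \<Sigma>. foldl \<delta> q0 w \<in> F}"
    using assms unfolding regular_lang_def by blast
  define tr where "tr w = (\<lambda>q\<in>Q. foldl \<delta> q w)" for w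
  have "(u, v) \<in> syn_cong \<Sigma> L"
    if "u \<in> lists \<Sigma>" "v \<in> lists \<Sigma>" "tr u = tr v" for u v
  proof -
    have "foldl \<delta> q u = foldl \<delta> q v" if "q \<in> Q" for q
      using \<open>tr u = tr v\<close> that unfolding tr_def by (metis restrict_apply')
    then show ?thesis
      using that foldl_closed[OF Q(2,3)] by (auto simp: syn_cong_def L)
  qed
  then have cls: "syn_cong \<Sigma> L `` {u} = syn_cong \<Sigma> L `` {v}"
    if "u \<in> lists \<Sigma>" "v \<in> lists \<Sigma>" "tr u = tr v" for u v
    using that by (intro equiv_class_eq[OF equiv_syn_cong]) auto
  have "tr w \<in> Q \<rightarrow>\<^sub>E Q" if "w \<in> lists \<Sigma>" for w
    using foldl_closed[OF _ Q(3) that] unfolding tr_def by simp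
  then have "tr ` lists \<Sigma> \<subseteq> Q \<rightarrow>\<^sub>E Q" by blast
  then have fin: "finite (tr ` lists \<Sigma>)"
    using Q(1) by (meson finite_PiE finite_subset)
  \<comment> \<open>Sends a transformation to the class of some word inducing it, so the classes
    form an image of a finite set.\<close>
  define c where "c x = syn_cong \<Sigma> L `` {SOME u. u \<in> lists \<Sigma> \<and> tr u = x}" for x
  have "syn_cong \<Sigma> L `` {u} = c (tr u)" if "u \<in> lists \<Sigma>" for u
  proof -
    have "(SOME v. v \<in> lists \<Sigma> \<and> tr v = tr u) \<in> lists \<Sigma> \<and>
        tr (SOME v. v \<in> lists \<Sigma> \<and> tr v = tr u) = tr u"
      by (rule someI[of _ u]) (use that in simp)
    then show ?thesis unfolding c_def using that by (intro cls) auto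
  qed
  then have "carrier (syn_monoid \<Sigma> L) \<subseteq> c ` tr ` lists \<Sigma>"
    by (auto simp: syn_monoid_def elim!: quotientE)
  then show ?thesis using fin by (meson finite_imageI finite_subset)
qed

subsection \<open>The syntactic monoid and the languages \<open>B\<^sup>*a\<^sub>1B\<^sup>*\<dots>a\<^sub>kB\<^sup>*\<close>\<close>

lemma syn_monoid_class_pow:
  assumes "u \<in> lists \<Sigma>"
  shows "(syn_cong \<Sigma> L `` {u}) [^]\<^bsub>syn_monoid \<Sigma> L\<^esub> (n::nat) =
    syn_cong \<Sigma> L `` {concat (replicate n u)}"
proof -
  interpret monoid "syn_monoid \<Sigma> L" by (rule monoid_syn_monoid)
  have car: "syn_cong \<Sigma> L `` {u} \<in> carrier (syn_monoid \<Sigma> L)"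
    using assms by (simp add: syn_monoid_def quotientI)
  have words: "concat (replicate n u) \<in> lists \<Sigma>" for n
    using assms by (auto simp: in_lists_conv_set)
  show ?thesis
  proof (induction n)
    case 0
    then show ?case by (simp add: syn_monoid_def)
  next
    case (Suc n)
    then show ?case
      unfolding nat_pow_Suc2[OF car] using syn_monoid_mult[OF assms words[of n], of L] by simp
  qed
qed

lemma ZG_monoid_syn_monoid_iff:
  assumes "regular_lang \<Sigma> L"
  shows "ZG_monoid (syn_monoid \<Sigma> L) \<longleftrightarrow>
    (\<forall>x\<in>carrier (syn_monoid \<Sigma> L). \<forall>y\<in>carrier (syn_monoid \<Sigma> L).
      (x [^]\<^bsub>syn_monoid \<Sigma> L\<^esub> (idem_power (syn_monoid \<Sigma> L) + 1)) \<otimes>\<^bsub>syn_monoid \<Sigma> L\<^esub> y =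
      y \<otimes>\<^bsub>syn_monoid \<Sigma> L\<^esub> (x [^]\<^bsub>syn_monoid \<Sigma> L\<^esub> (idem_power (syn_monoid \<Sigma> L) + 1)))"
  unfolding ZG_monoid_def using monoid_syn_monoid finite_syn_monoid[OF assms] by blast

text \<open>Disjointness forces the marked letters to be exactly the letters outside
  \<open>B\<close>, so erasing \<open>B\<close> reveals them in order.\<close>

lemma star_word_lang_iff:
  assumes "B \<inter> set as = {}"
  shows "w \<in> star_word_lang B as \<longleftrightarrow> filter (\<lambda>c. c \<notin> B) w = as"
  using assms
proof (induction as arbitrary: w)
  case Nil
  then show ?case by (auto simp: filter_empty_conv in_lists_conv_set)
next
  case (Cons a as)
  have "w \<in> star_word_lang B (a # as) \<longleftrightarrow>
      (\<exists>u v. w = u @ a # v \<and> u \<in> lists B \<and> v \<in> star_word_lang B as)"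
    by (auto simp: conc_def)
  also have "\<dots> \<longleftrightarrow> (\<exists>u v. w = u @ a # v \<and> (\<forall>c\<in>set u. c \<in> B) \<and> filter (\<lambda>c. c \<notin> B) v = as)"
    using Cons by (auto simp: in_lists_conv_set)
  also have "\<dots> \<longleftrightarrow> filter (\<lambda>c. c \<notin> B) w = a # as"
    using Cons.prems by (auto simp: filter_eq_Cons_iff)
  finally show ?case .
qed

lemma power_moves_in_star_word_lang:
  assumes "B \<inter> set as = {}" "length as < m"
  shows "s @ concat (replicate m x) @ y @ t \<in> star_word_lang B as \<longleftrightarrow>
    s @ y @ concat (replicate m x) @ t \<in> star_word_lang B as"
proof -
  define r where "r = filter (\<lambda>c. c \<notin> B)"
  have pow: "r (concat (replicate m x)) = concat (replicate m (r x))" for m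
    by (induction m) (simp_all add: r_def)
  have len: "length (concat (replicate m (r x))) = m * length (r x)"
    by (simp add: length_concat sum_list_replicate)
  have empty: "r x = []" if "m * length (r x) \<le> length as"
    using that assms(2) by (cases "r x") auto
  have "r s @ concat (replicate m (r x)) @ r y @ r t = as \<longleftrightarrow>
      r s @ r y @ concat (replicate m (r x)) @ r t = as"
  proof (cases "r x = []")
    \<comment> \<open>Both words then contain too many letters outside \<open>B\<close>, so neither
      equation can hold.\<close>
    case False
    then have "\<not> m * length (r x) \<le> length as" using empty by blast
    then show ?thesis unfolding len[symmetric] by auto
  qed simp
  then show ?thesis
    unfolding star_word_lang_iff[OF assms(1)] pow[symmetric] by (simp add: r_def)
qed

lemma commutative_lang_mset:
  "commutative_lang K \<Longrightarrow> mset u = mset v \<Longrightarrow> u \<in> K \<longleftrightarrow> v \<in> K"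
  unfolding commutative_lang_def by metis

section \<open>The two directions of the characterisation\<close>

text \<open>The exponent \<open>k + 1\<close> is replaced by a larger one giving the same power in
  the syntactic monoid, large enough that powers move freely inside every member of the
  union.\<close>

lemma ZG_lang_of_star_word_union:
  assumes "regular_lang \<Sigma> L" and "finite \<C>" and L: "L = \<Union>\<C>"
    and \<C>: "\<And>X. X \<in> \<C> \<Longrightarrow> \<exists>B as K. B \<inter> set as = {} \<and> commutative_lang K \<and> X = star_word_lang B as \<inter> K"
  shows "ZG_lang \<Sigma> L"
proof -
  let ?M = "syn_monoid \<Sigma> L"
  interpret monoid ?M by (rule monoid_syn_monoid)
  note fin = finite_syn_monoid[OF assms(1)]
  obtain B as K where "\<And>X. X \<in> \<C> \<Longrightarrow>
      B X \<inter> set (as X) = {} \<and> commutative_lang (K X) \<and> X = star_word_lang (B X) (as X) \<inter> K X"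
    using \<C> by metis
  note BK = this[THEN conjunct1] this[THEN conjunct2, THEN conjunct1]
    this[THEN conjunct2, THEN conjunct2]
  define k where "k = idem_power ?M"
  define N where "N = (\<Sum>X\<in>\<C>. length (as X))"
  \<comment> \<open>\<open>m\<close> exceeds every \<open>length (as X)\<close>, and being 1 plus a
    positive multiple of \<open>k\<close> it yields the same powers as \<open>k + 1\<close>.\<close>
  define m where "m = k * Suc N + 1"
  have k: "0 < k" using idem_power_pos[OF fin] by (simp add: k_def)
  have "length (as X) < m" if "X \<in> \<C>" for X
  proof -
    have "length (as X) \<le> N"
      unfolding N_def using that \<open>finite \<C>\<close> by (intro member_le_sum) auto
    also have "N \<le> k * Suc N" using k by (cases k) auto
    finally show ?thesis by (simp add: m_def)
  qed
  note long = this
  have "s @ concat (replicate m x) @ y @ t \<in> L \<longleftrightarrow> s @ y @ concat (replicate m x) @ t \<in> L" for s t x y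
  proof -
    have "s @ concat (replicate m x) @ y @ t \<in> X \<longleftrightarrow> s @ y @ concat (replicate m x) @ t \<in> X"
      if X: "X \<in> \<C>" for X
    proof -
      \<comment> \<open>The two words are permutations of each other.\<close>
      have "s @ concat (replicate m x) @ y @ t \<in> K X \<longleftrightarrow> s @ y @ concat (replicate m x) @ t \<in> K X"
        by (rule commutative_lang_mset[OF BK(2)[OF X]]) simp
      then show ?thesis
        using BK(3)[OF X] power_moves_in_star_word_lang[OF BK(1)[OF X] long[OF X], of s x y t] by blast
    qed
    then show ?thesis unfolding L by blast
  qed
  then have comm: "syn_cong \<Sigma> L `` {concat (replicate m x) @ y} = syn_cong \<Sigma> L `` {y @ concat (replicate m x)}"
    if "x \<in> lists \<Sigma>" "y \<in> lists \<Sigma>" for x y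
    using that by (intro equiv_class_eq[OF equiv_syn_cong]) (auto simp: syn_cong_def in_lists_conv_set)
  have "X [^]\<^bsub>?M\<^esub> (k + 1) \<otimes>\<^bsub>?M\<^esub> Y = Y \<otimes>\<^bsub>?M\<^esub> X [^]\<^bsub>?M\<^esub> (k + 1)"
    if X: "X \<in> carrier ?M" and Y: "Y \<in> carrier ?M" for X Y
  proof -
    obtain x y where x: "x \<in> lists \<Sigma>" "X = syn_cong \<Sigma> L `` {x}"
      and y: "y \<in> lists \<Sigma>" "Y = syn_cong \<Sigma> L `` {y}"
      using X Y by (auto simp: syn_monoid_def elim!: quotientE)
    have "X [^]\<^bsub>?M\<^esub> m = X [^]\<^bsub>?M\<^esub> (k + 1)"
      using idem_pow_mult[OF X idem_power_idem[OF fin X], of N] by (simp add: m_def k_def)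
    moreover have "concat (replicate m x) \<in> lists \<Sigma>" using x(1) by (auto simp: in_lists_conv_set)
    then have "X [^]\<^bsub>?M\<^esub> m \<otimes>\<^bsub>?M\<^esub> Y = Y \<otimes>\<^bsub>?M\<^esub> X [^]\<^bsub>?M\<^esub> m"
      unfolding x(2) y(2) syn_monoid_class_pow[OF x(1)]
      using comm[OF x(1) y(1)] y(1) by (simp add: syn_monoid_mult)
    ultimately show ?thesis by simp
  qed
  then show ?thesis
    unfolding ZG_lang_def ZG_monoid_syn_monoid_iff[OF assms(1)] using assms(1) by (simp add: k_def)
qed

text \<open>Words of \<open>L\<close> are grouped by their set of frequent letters and their subword
  of rare letters; each group yields one member of the union.\<close>

lemma star_word_union_of_ZG_lang:
  assumes "finite \<Sigma>" and "ZG_lang \<Sigma> L"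
  shows "\<exists>\<C>. finite \<C> \<and> L = \<Union>\<C> \<and>
       (\<forall>X\<in>\<C>. \<exists>B as K.
          B \<subseteq> \<Sigma> \<and> set as \<subseteq> \<Sigma> \<and> B \<inter> set as = {} \<and>
          regular_lang \<Sigma> K \<and> commutative_lang K \<and>
          X = star_word_lang B as \<inter> K)"
proof -
  let ?M = "syn_monoid \<Sigma> L"
  let ?h = "\<lambda>w. syn_cong \<Sigma> L `` {w}"
  have reg: "regular_lang \<Sigma> L" and ZG: "ZG_monoid ?M"
    using assms(2) by (simp_all add: ZG_lang_def)
  have L: "L \<subseteq> lists \<Sigma>" using reg by (auto simp: regular_lang_def)
  have fin: "finite (carrier ?M)" using reg by (rule finite_syn_monoid)
  define k where "k = idem_power ?M"
  define n where "n = card (carrier ?M)"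
  have k: "0 < k"
    unfolding k_def by (rule monoid.idem_power_pos[OF monoid_syn_monoid fin])
  \<comment> \<open>The morphism is the canonical projection onto the syntactic monoid.\<close>
  interpret zg_word_morphism ?M k \<Sigma> ?h
  proof (intro zg_word_morphism.intro zg_monoid.intro zg_monoid_axioms.intro
      zg_word_morphism_axioms.intro)
    show "monoid ?M" by (rule monoid_syn_monoid)
    show "(x [^]\<^bsub>?M\<^esub> k) \<otimes>\<^bsub>?M\<^esub> (x [^]\<^bsub>?M\<^esub> k) = x [^]\<^bsub>?M\<^esub> k" if "x \<in> carrier ?M" for x
      unfolding k_def by (rule monoid.idem_power_idem[OF monoid_syn_monoid fin that])
    show "x [^]\<^bsub>?M\<^esub> (k + 1) \<otimes>\<^bsub>?M\<^esub> y = y \<otimes>\<^bsub>?M\<^esub> x [^]\<^bsub>?M\<^esub> (k + 1)"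
      if "x \<in> carrier ?M" "y \<in> carrier ?M" for x y
      using ZG that unfolding ZG_monoid_def k_def by blast
    show "?h w \<in> carrier ?M" if "w \<in> lists \<Sigma>" for w
      using that by (simp add: syn_monoid_def quotientI)
    show "?h (v @ w) = ?h v \<otimes>\<^bsub>?M\<^esub> ?h w" if "v \<in> lists \<Sigma>" "w \<in> lists \<Sigma>" for v w
      by (rule syn_monoid_mult[OF that, symmetric])
  qed fact+
  define F where "F w = {b \<in> \<Sigma>. n < count_list w b}" for w
  define r where "r B w = filter (\<lambda>c. c \<notin> B) w" for B :: "'a set" and w
  \<comment> \<open>Besides frequency of the letters in \<open>B\<close>, this asks that their
    residues agree with those of some word of \<open>L\<close> in the same group. It constrains
    \<open>v\<close> only through its letter counts.\<close>
  define K where "K B as = {v \<in> lists \<Sigma>. (\<forall>b\<in>B. n < count_list v b) \<and>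
    (\<exists>w\<in>L. F w = B \<and> r B w = as \<and> (\<forall>b\<in>B. count_list v b mod k = count_list w b mod k))}" for B as
  define I where "I = (\<lambda>w. (F w, r (F w) w)) ` L"
  define \<C> where "\<C> = (\<lambda>(B, as). star_word_lang B as \<inter> K B as) ` I"
  have I: "B \<subseteq> \<Sigma> \<and> set as \<subseteq> \<Sigma> \<and> B \<inter> set as = {}" if "(B, as) \<in> I" for B as
    using that L by (auto simp: I_def F_def r_def)
  \<comment> \<open>Each rare letter occurs at most \<open>n\<close> times, so only finitely many
    pairs can be indices.\<close>
  have "length (r (F w) w) \<le> n * card \<Sigma>" if "w \<in> L" for w
  proof -
    have "w \<in> lists \<Sigma>" using that L by blast
    then have "length (r (F w) w) = (\<Sum>a\<in>\<Sigma>. count_list (r (F w) w) a)"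
      using \<open>finite \<Sigma>\<close> by (intro sum_count_set[symmetric]) (auto simp: r_def)
    also have "\<dots> \<le> (\<Sum>a\<in>\<Sigma>. n)"
    proof (rule sum_mono)
      fix a assume "a \<in> \<Sigma>"
      have "count_list (r B w) a = (if a \<in> B then 0 else count_list w a)" for B
        unfolding r_def by (induction w) auto
      then show "count_list (r (F w) w) a \<le> n"
        using \<open>a \<in> \<Sigma>\<close> by (simp add: F_def)
    qed
    finally show ?thesis by (simp add: mult.commute)
  qed
  then have "I \<subseteq> Pow \<Sigma> \<times> {as. set as \<subseteq> \<Sigma> \<and> length as \<le> n * card \<Sigma>}"
    using I by (fastforce simp: I_def)
  moreover have "finite (Pow \<Sigma> \<times> {as. set as \<subseteq> \<Sigma> \<and> length as \<le> n * card \<Sigma>})"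
    using \<open>finite \<Sigma>\<close> by (simp add: finite_lists_length_le)
  ultimately have "finite I" by (rule finite_subset)
  then have "finite \<C>" by (simp add: \<C>_def)
  moreover have "L = \<Union>\<C>"
  proof
    show "L \<subseteq> \<Union>\<C>"
    proof
      fix w assume w: "w \<in> L"
      then have idx: "(F w, r (F w) w) \<in> I" by (auto simp: I_def)
      have "w \<in> star_word_lang (F w) (r (F w) w)"
        using I[OF idx] by (simp add: star_word_lang_iff r_def)
      moreover have "w \<in> K (F w) (r (F w) w)"
        using w L by (auto simp: K_def F_def)
      ultimately show "w \<in> \<Union>\<C>" using idx by (auto simp: \<C>_def)
    qed
    show "\<Union>\<C> \<subseteq> L"
    proof
      fix v assume "v \<in> \<Union>\<C>"
      then obtain B as where idx: "(B, as) \<in> I" and v: "v \<in> star_word_lang B as" "v \<in> K B as"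
        by (auto simp: \<C>_def)
      then obtain w where w: "w \<in> L" "F w = B" "r B w = as"
        and mod: "\<And>b. b \<in> B \<Longrightarrow> count_list v b mod k = count_list w b mod k"
        by (auto simp: K_def)
      have v': "v \<in> lists \<Sigma>" "\<And>b. b \<in> B \<Longrightarrow> n < count_list v b" using v(2) by (auto simp: K_def)
      have "r B v = r B w"
        using v(1) w(3) I[OF idx] by (simp add: star_word_lang_iff r_def)
      \<comment> \<open>The rare subwords agree by membership in the star language, the residues by
        membership in \<open>K B as\<close>.\<close>
      have "?h v = ?h w"
      proof (rule image_determined[OF _ _ v'(1)])
        show B: "B \<subseteq> \<Sigma>" using I[OF idx] by blast
        show "finite B" using B \<open>finite \<Sigma>\<close> by (rule finite_subset)
        show "w \<in> lists \<Sigma>" using w(1) L by blast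
        show "card (carrier ?M) < count_list v b" if "b \<in> B" for b
          using v'(2)[OF that] unfolding n_def .
        show "card (carrier ?M) < count_list w b" if "b \<in> B" for b
          using that unfolding w(2)[symmetric] F_def n_def by blast
        show "filter (\<lambda>c. c \<notin> B) v = filter (\<lambda>c. c \<notin> B) w"
          using \<open>r B v = r B w\<close> unfolding r_def .
      qed (rule mod)
      then have "(v, w) \<in> syn_cong \<Sigma> L"
        by (rule eq_equiv_class[OF _ equiv_syn_cong]) (use w(1) L in blast)
      then have "\<forall>s\<in>lists \<Sigma>. \<forall>t\<in>lists \<Sigma>. s @ v @ t \<in> L \<longleftrightarrow> s @ w @ t \<in> L"
        by (simp add: syn_cong_def)
      \<comment> \<open>Empty contexts turn syntactic congruence into equivalence of membership in
        \<open>L\<close>.\<close>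
      then have "[] @ v @ [] \<in> L \<longleftrightarrow> [] @ w @ [] \<in> L"
        by (metis lists.Nil)
      then show "v \<in> L" using w(1) by simp
    qed
  qed
  moreover have reg_K: "regular_lang \<Sigma> (K B as)" if "(B, as) \<in> I" for B as
  proof (rule regular_count_lang[OF \<open>finite \<Sigma>\<close> k])
    show "K B as \<subseteq> lists \<Sigma>" by (auto simp: K_def)
    fix u v assume u: "u \<in> K B as" and v: "v \<in> lists \<Sigma>"
      and thr: "\<And>a. a \<in> \<Sigma> \<Longrightarrow> min (Suc n) (count_list u a) = min (Suc n) (count_list v a)"
      and mod: "\<And>a. a \<in> \<Sigma> \<Longrightarrow> count_list u a mod k = count_list v a mod k"
    have B: "b \<in> \<Sigma>" if "b \<in> B" for b using I[OF \<open>(B, as) \<in> I\<close>] that by blast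
    have many: "n < count_list v b" if "b \<in> B" for b
    proof -
      have "n < count_list u b" using u that unfolding K_def by blast
      then show ?thesis using thr[OF B[OF that]] by linarith
    qed
    obtain w where w: "w \<in> L" "F w = B" "r B w = as"
      "\<forall>b\<in>B. count_list u b mod k = count_list w b mod k"
      using u unfolding K_def by blast
    \<comment> \<open>The same witness \<open>w\<close> serves for \<open>v\<close>, since the
      residues of \<open>u\<close> and \<open>v\<close> agree.\<close>
    show "v \<in> K B as"
      unfolding K_def
    proof (intro CollectI conjI ballI bexI[of _ w])
      fix b assume "b \<in> B"
      show "n < count_list v b" using \<open>b \<in> B\<close> by (rule many)
      show "count_list v b mod k = count_list w b mod k"
        using w(4) mod[OF B[OF \<open>b \<in> B\<close>]] \<open>b \<in> B\<close> by simp
    qed fact+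
  qed
  moreover have comm_K: "commutative_lang (K B as)" for B as
    unfolding commutative_lang_def
  proof (intro ballI allI impI)
    fix u v assume u: "u \<in> K B as" and "mset v = mset u"
    have "set v = set u" using \<open>mset v = mset u\<close> by (rule mset_eq_setD)
    moreover have "count_list v b = count_list u b" for b
      using \<open>mset v = mset u\<close> by (simp flip: count_mset)
    ultimately show "v \<in> K B as" using u unfolding K_def in_lists_conv_set by simp
  qed
  ultimately show ?thesis
  proof (intro exI[of _ \<C>] conjI ballI)
    fix X assume "X \<in> \<C>"
    then obtain B as where "(B, as) \<in> I" "X = star_word_lang B as \<inter> K B as"
      by (auto simp: \<C>_def)
    then show "\<exists>B as K. B \<subseteq> \<Sigma> \<and> set as \<subseteq> \<Sigma> \<and> B \<inter> set as = {} \<and>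
        regular_lang \<Sigma> K \<and> commutative_lang K \<and> X = star_word_lang B as \<inter> K"
      using I reg_K comm_K by (intro exI[of _ B] exI[of _ as] exI[of _ "K B as"]) simp
  qed
qed

theorem corollary3p5:
  fixes \<Sigma> :: "'a set" and L :: "'a list set"
  assumes "finite \<Sigma>" and "regular_lang \<Sigma> L"
  shows "ZG_lang \<Sigma> L \<longleftrightarrow>
    (\<exists>\<C> :: 'a list set set. finite \<C> \<and> L = \<Union>\<C> \<and>
       (\<forall>X\<in>\<C>. \<exists>B as K.
          B \<subseteq> \<Sigma> \<and> set as \<subseteq> \<Sigma> \<and> B \<inter> set as = {} \<and>
          regular_lang \<Sigma> K \<and> commutative_lang K \<and>
          X = star_word_lang B as \<inter> K))"
proof
  assume "ZG_lang \<Sigma> L"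
  with assms(1) show "\<exists>\<C>. finite \<C> \<and> L = \<Union>\<C> \<and>
       (\<forall>X\<in>\<C>. \<exists>B as K.
          B \<subseteq> \<Sigma> \<and> set as \<subseteq> \<Sigma> \<and> B \<inter> set as = {} \<and>
          regular_lang \<Sigma> K \<and> commutative_lang K \<and>
          X = star_word_lang B as \<inter> K)"
    by (rule star_word_union_of_ZG_lang)
next
  assume "\<exists>\<C>. finite \<C> \<and> L = \<Union>\<C> \<and>
       (\<forall>X\<in>\<C>. \<exists>B as K.
          B \<subseteq> \<Sigma> \<and> set as \<subseteq> \<Sigma> \<and> B \<inter> set as = {} \<and>
          regular_lang \<Sigma> K \<and> commutative_lang K \<and>
          X = star_word_lang B as \<inter> K)"
  then obtain \<C> where \<C>: "finite \<C>" "L = \<Union>\<C>"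
    and forms: "\<forall>X\<in>\<C>. \<exists>B as K.
          B \<subseteq> \<Sigma> \<and> set as \<subseteq> \<Sigma> \<and> B \<inter> set as = {} \<and>
          regular_lang \<Sigma> K \<and> commutative_lang K \<and>
          X = star_word_lang B as \<inter> K"
    by (elim exE conjE)
  have "\<exists>B as K. B \<inter> set as = {} \<and> commutative_lang K \<and> X = star_word_lang B as \<inter> K"
    if "X \<in> \<C>" for X
    using forms[rule_format, OF that] by (elim exE conjE) (intro exI conjI)
  with assms(2) \<C> show "ZG_lang \<Sigma> L" by (rule ZG_lang_of_star_word_union)
qed

end
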